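(* Let $(X,d_X,\leq_{P_1})$ and $(Y,d_Y,\leq_{P_2})$ be two partially ordered complete metric spaces and let $F:X\times Y\rightarrow X$, $G:Y\times X\rightarrow Y$ be two continuous mappings having the mixed monotone property. Suppose that for every $(x,y),(x^*,y^* )\in X\times Y$ there exists $(z_1,z_2)\in X\times Y$ that is comparable to both $(x,y)$ and $(x^*,y^* )$. Assume that there exist $k,l,m,n\in [0,1)$ with $k+l<1$ and $m+n<1$ such that $$d_X(F(x,y),F(u,v))\leq k\, d_X(x,u)+l\, d_Y(y,v)\quad \text{for all } x,u\in X,\ y,v\in Y \text{ with } x\geq_{P_1}u,\ y\leq_{P_2}v,$$ $$d_Y(G(y,x),G(v,u))\leq m\, d_Y(y,v)+n\, d_X(x,u)\quad \text{for all } x,u\in X,\ y,v\in Y \text{ with } x\leq_{P_1}u,\ y\geq_{P_2}v.$$ If there exist $x_0\in X$, $y_0\in Y$ such that $x_0\leq_{P_1} F(x_0, y_0)$ and $y_0\geq_{P_2} G(y_0, x_0)$, then there exists a unique FG-coupled fixed point, i.e. a unique $(x,y)\in X\times Y$ with $F(x,y)=x$ and $G(y,x)=y$.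
   Context: A partially ordered complete metric space $(X,d_X,\leq_{P_1})$ is a set $X$ with a metric $d_X$ for which it is complete and a partial order $\leq_{P_1}$ (no compatibility between them is assumed). The product $X\times Y$ carries the metric $d((x,y),(u,v))=d_X(x,u)+d_Y(y,v)$ (similarly for $Y\times X$) and the partial order $(u,v)\leq (x,y)\Leftrightarrow x\geq_{P_1}u$ and $y\leq_{P_2} v$; two elements $p,q$ of $X\times Y$ are comparable if $p\leq q$ or $q\leq p$ in this order. The maps $F:X\times Y\to X$ and $G:Y\times X\to Y$ have the mixed monotone property if for all $x\in X$, $y\in Y$: for all $x_1,x_2\in X$, $x_1\leq_{P_1} x_2$ implies $F(x_1,y)\leq_{P_1} F(x_2,y)$ and $G(y,x_1)\geq_{P_2}G(y,x_2)$; and for all $y_1,y_2\in Y$, $y_1\leq_{P_2}y_2$ implies $F(x,y_1)\geq_{P_1}F(x,y_2)$ and $G(y_1,x)\leq_{P_2}G(y_2,x)$. *)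

theory Defs
  imports "HOL-Analysis.Analysis"
begin

text \<open>
  A partially ordered complete metric space is a type of class
  \<open>{complete_space, order}\<close>; the two classes are unrelated, so no compatibility between
  metric and order is implied.
\<close>

text \<open>
  The library metric on product types is the Euclidean combination of the component metrics.
  Here the product carries the sum metric, and an order that is reversed in the second component.
\<close>

definition sum_dist ::
  "'a::metric_space \<times> 'b::metric_space \<Rightarrow> 'a \<times> 'b \<Rightarrow> real" where
  "sum_dist p q = dist (fst p) (fst q) + dist (snd p) (snd q)"

lemma Metric_space_sum_dist: "Metric_space UNIV sum_dist"
proof
  fix p q r :: "'a \<times> 'b"
  show "sum_dist p r \<le> sum_dist p q + sum_dist q r"
    unfolding sum_dist_def
    using dist_triangle[of "fst p" "fst r" "fst q"] dist_triangle[of "snd p" "snd r" "snd q"]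
    by linarith
qed (auto simp: sum_dist_def dist_commute prod_eq_iff add_nonneg_eq_0_iff)

definition sum_continuous ::
  "('a::metric_space \<times> 'b::metric_space \<Rightarrow> 'c::metric_space) \<Rightarrow> bool" where
  "sum_continuous f \<longleftrightarrow>
     continuous_map (Metric_space.mtopology UNIV sum_dist) euclidean f"

definition prod_le :: "'a::order \<times> 'b::order \<Rightarrow> 'a \<times> 'b \<Rightarrow> bool" where
  "prod_le p q \<longleftrightarrow> fst q \<ge> fst p \<and> snd q \<le> snd p"

definition prod_comparable :: "'a::order \<times> 'b::order \<Rightarrow> 'a \<times> 'b \<Rightarrow> bool" where
  "prod_comparable p q \<longleftrightarrow> prod_le p q \<or> prod_le q p"

definition mixed_monotone ::
  "('a::order \<times> 'b::order \<Rightarrow> 'a) \<Rightarrow> ('b \<times> 'a \<Rightarrow> 'b) \<Rightarrow> bool" where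
  "mixed_monotone F G \<longleftrightarrow>
     (\<forall>x y.
        (\<forall>x1 x2. x1 \<le> x2 \<longrightarrow> F (x1, y) \<le> F (x2, y) \<and> G (y, x1) \<ge> G (y, x2)) \<and>
        (\<forall>y1 y2. y1 \<le> y2 \<longrightarrow> F (x, y1) \<ge> F (x, y2) \<and> G (y1, x) \<le> G (y2, x)))"

definition FG_coupled_fixed_point ::
  "('a \<times> 'b \<Rightarrow> 'a) \<Rightarrow> ('b \<times> 'a \<Rightarrow> 'b) \<Rightarrow> 'a \<times> 'b \<Rightarrow> bool" where
  "FG_coupled_fixed_point F G p \<longleftrightarrow> (case p of (x, y) \<Rightarrow> F (x, y) = x \<and> G (y, x) = y)"

end

theory Submission
  imports Defs
begin

text \<open>
  Put \<open>T (x, y) = (F (x, y), G (y, x))\<close>. Mixed monotonicity makes \<open>T\<close> monotone for the product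
  order, and since \<open>k + l < 1\<close> and \<open>m + n < 1\<close> bound row sums, \<open>T\<close> contracts the
  \<^emph>\<open>maximum\<close> distance of comparable pairs by the factor \<open>max (k + l) (m + n)\<close> (the sum
  distance need not contract, as \<open>k + n\<close> may exceed \<open>1\<close>). The orbit of \<open>(x0, y0)\<close> is
  a chain, hence Cauchy, and its limit is fixed by continuity. For two fixed points, the orbit of an
  element comparable to both converges to both.
\<close>

text \<open>Distances between later terms are dominated by a geometric tail, so the sequence is
  Cauchy and completeness applies. All estimates are multiplied by \<open>1 - c\<close> to avoid
  division.\<close>

lemma convergent_if_dist_Suc_le_geometric:
  fixes s :: "nat \<Rightarrow> 'a::complete_space"
  assumes c: "0 \<le> c" "c < 1"
    and step: "\<And>i. dist (s i) (s (Suc i)) \<le> C * c ^ i"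
  shows "convergent s"
proof -
  have C: "0 \<le> C"
    using order_trans[OF zero_le_dist step[of 0]] by simp
  \<comment> \<open>The right side is the exact partial geometric sum times \<open>1 - c\<close>;
    the subtracted term \<open>c ^ j\<close> is what lets the induction on \<open>j\<close>
    close.\<close>
  have tail: "(1 - c) * dist (s i) (s (i + j)) \<le> C * c ^ i * (1 - c ^ j)" for i j
  proof (induction j)
    case 0
    show ?case by simp
  next
    case (Suc j)
    have "dist (s i) (s (i + Suc j)) \<le> dist (s i) (s (i + j)) + C * c ^ (i + j)"
      using dist_triangle[of "s i" "s (i + Suc j)" "s (i + j)"] step[of "i + j"] by simp
    then have "(1 - c) * dist (s i) (s (i + Suc j))
        \<le> (1 - c) * (dist (s i) (s (i + j)) + C * c ^ (i + j))"
      using c by (intro mult_left_mono) auto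
    also have "\<dots> = (1 - c) * dist (s i) (s (i + j)) + (1 - c) * (C * c ^ (i + j))"
      by (rule distrib_left)
    also have "\<dots> \<le> C * c ^ i * (1 - c ^ j) + (1 - c) * (C * c ^ (i + j))"
      using Suc.IH by simp
    also have "\<dots> = C * c ^ i * (1 - c ^ Suc j)"
      by (simp add: algebra_simps power_add)
    finally show ?case .
  qed
  have bound: "(1 - c) * dist (s i) (s j) \<le> C * c ^ i" if "i \<le> j" for i j
  proof -
    have "(1 - c) * dist (s i) (s j) \<le> C * c ^ i * (1 - c ^ (j - i))"
      using tail[of i "j - i"] that by simp
    also have "\<dots> \<le> C * c ^ i * 1"
      using c C by (intro mult_left_mono) auto
    finally show ?thesis by simp
  qed
  have "(\<lambda>i. C * c ^ i) \<longlonglongrightarrow> C * 0"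
    using c by (intro tendsto_mult tendsto_const LIMSEQ_power_zero) auto
  then have lim: "(\<lambda>i. C * c ^ i) \<longlonglongrightarrow> 0"
    by simp
  have "Cauchy s"
    unfolding Cauchy_altdef2
  proof (intro allI impI)
    fix e :: real
    assume "0 < e"
    then have "0 < (1 - c) * e"
      using c by simp
    from eventually_happens'[OF sequentially_bot order_tendstoD(2)[OF lim this]]
    obtain N where N: "C * c ^ N < (1 - c) * e" ..
    have "dist (s j) (s N) < e" if "N \<le> j" for j
    proof -
      have "(1 - c) * dist (s j) (s N) < (1 - c) * e"
        using bound[OF that] N by (simp add: dist_commute)
      then show ?thesis
        using c by simp
    qed
    then show "\<exists>N. \<forall>j\<ge>N. dist (s j) (s N) < e"
      by blast
  qed
  then show ?thesis
    by (rule Cauchy_convergent)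
qed

text \<open>\<open>sum_continuous\<close> refers to the topology of \<open>sum_dist\<close>, not to
  the product type's own topology. Componentwise convergence sends \<open>sum_dist\<close> to 0,
  hence is convergence in the former, which \<open>f\<close> preserves.\<close>

lemma tendsto_sum_continuous:
  assumes f: "sum_continuous f" and x: "X \<longlonglongrightarrow> x" and y: "Y \<longlonglongrightarrow> y"
  shows "(\<lambda>i. f (X i, Y i)) \<longlonglongrightarrow> f (x, y)"
proof -
  interpret Metric_space "UNIV :: ('a \<times> 'b) set" sum_dist
    by (rule Metric_space_sum_dist)
  have "(\<lambda>i. dist (X i) x + dist (Y i) y) \<longlonglongrightarrow> 0"
    using tendsto_add[OF tendsto_dist_iff[THEN iffD1, OF x] tendsto_dist_iff[THEN iffD1, OF y]]
    by simp
  then have "limitin mtopology (\<lambda>i. (X i, Y i)) (x, y) sequentially"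
    by (simp add: limitin_metric_dist_null sum_dist_def)
  then have "limitin euclidean (f \<circ> (\<lambda>i. (X i, Y i))) (f (x, y)) sequentially"
    using f unfolding sum_continuous_def by (rule continuous_map_limit[rotated])
  then show ?thesis
    by (simp add: o_def)
qed

definition max_dist :: "'a::metric_space \<times> 'b::metric_space \<Rightarrow> 'a \<times> 'b \<Rightarrow> real" where
  "max_dist p q = max (dist (fst p) (fst q)) (dist (snd p) (snd q))"

lemma max_dist_commute: "max_dist p q = max_dist q p"
  by (simp add: max_dist_def dist_commute)

lemma dist_fst_le_max_dist: "dist (fst p) (fst q) \<le> max_dist p q"
  and dist_snd_le_max_dist: "dist (snd p) (snd q) \<le> max_dist p q"
  by (simp_all add: max_dist_def)

definition coupled_map :: "('a \<times> 'b \<Rightarrow> 'a) \<Rightarrow> ('b \<times> 'a \<Rightarrow> 'b) \<Rightarrow> 'a \<times> 'b \<Rightarrow> 'a \<times> 'b" where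
  "coupled_map F G p = (F p, G (snd p, fst p))"

lemma FG_coupled_fixed_point_iff: "FG_coupled_fixed_point F G p \<longleftrightarrow> coupled_map F G p = p"
  by (cases p) (simp add: FG_coupled_fixed_point_def coupled_map_def)

text \<open>Change one coordinate at a time, from \<open>(x, y)\<close> through
  \<open>(u, y)\<close> to \<open>(u, v)\<close>: each move raises the value of \<open>F\<close> and
  lowers that of \<open>G\<close>.\<close>

lemma prod_le_coupled_map:
  assumes "mixed_monotone F G" and "prod_le p q"
  shows "prod_le (coupled_map F G p) (coupled_map F G q)"
proof -
  obtain x y u v where pq: "p = (x, y)" "q = (u, v)"
    by (cases p, cases q)
  then have le: "x \<le> u" "v \<le> y"
    using assms(2) by (simp_all add: prod_le_def)
  have "F (x, y) \<le> F (u, y)" "F (u, y) \<le> F (u, v)" "G (v, u) \<le> G (y, u)" "G (y, u) \<le> G (y, x)"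
    using assms(1) le unfolding mixed_monotone_def by blast+
  then show ?thesis
    by (auto simp: prod_le_def coupled_map_def pq)
qed

lemma max_dist_coupled_map_le:
  assumes "prod_comparable p q"
    and nonneg: "0 \<le> k" "0 \<le> l" "0 \<le> m" "0 \<le> n"
    and F: "\<And>x u y v. x \<ge> u \<Longrightarrow> y \<le> v \<Longrightarrow>
              dist (F (x, y)) (F (u, v)) \<le> k * dist x u + l * dist y v"
    and G: "\<And>x u y v. x \<le> u \<Longrightarrow> y \<ge> v \<Longrightarrow>
              dist (G (y, x)) (G (v, u)) \<le> m * dist y v + n * dist x u"
  shows "max_dist (coupled_map F G p) (coupled_map F G q) \<le> max (k + l) (m + n) * max_dist p q"
proof -
  \<comment> \<open>\<open>max_dist\<close> is symmetric, so it suffices to treat one direction of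
    comparability.\<close>
  have *: "max_dist (coupled_map F G p) (coupled_map F G q) \<le> max (k + l) (m + n) * max_dist p q"
    if le: "prod_le p q" for p q
  proof -
    obtain x y u v where pq: "p = (x, y)" "q = (u, v)"
      by (cases p, cases q)
    define D where "D = max_dist p q"
    have D: "dist x u \<le> D" "dist y v \<le> D" "0 \<le> D"
      by (auto simp: D_def max_dist_def pq le_max_iff_disj)
    have xy: "x \<le> u" "v \<le> y"
      using le by (simp_all add: prod_le_def pq)
    \<comment> \<open>The hypotheses on \<open>F\<close> and \<open>G\<close> are oriented
      oppositely: for \<open>prod_le p q\<close>, the one on \<open>F\<close> applies with the two
      points swapped, the one on \<open>G\<close> directly.\<close>
    have "dist (F (x, y)) (F (u, v)) \<le> k * dist x u + l * dist y v"
      using F[OF xy] by (simp add: dist_commute)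
    also have "\<dots> \<le> (k + l) * D"
      unfolding distrib_right using D nonneg by (intro add_mono mult_left_mono)
    also have "\<dots> \<le> max (k + l) (m + n) * D"
      using D by (intro mult_right_mono) auto
    finally have 1: "dist (F (x, y)) (F (u, v)) \<le> max (k + l) (m + n) * D" .
    have "dist (G (y, x)) (G (v, u)) \<le> m * dist y v + n * dist x u"
      using G[OF xy] .
    also have "\<dots> \<le> (m + n) * D"
      unfolding distrib_right using D nonneg by (intro add_mono mult_left_mono)
    also have "\<dots> \<le> max (k + l) (m + n) * D"
      using D by (intro mult_right_mono) auto
    finally show ?thesis
      using 1 unfolding D_def by (simp add: max_dist_def coupled_map_def pq)
  qed
  show ?thesis
    using assms(1) *[of p q] *[of q p]
    by (auto simp: prod_comparable_def max_dist_commute[of q]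
        max_dist_commute[of "coupled_map F G q"])
qed

theorem theorem2p2:
  fixes F :: "'a::{complete_space, order} \<times> 'b::{complete_space, order} \<Rightarrow> 'a"
    and G :: "'b \<times> 'a \<Rightarrow> 'b"
    and k l m n :: real
    and x0 :: 'a and y0 :: 'b
  assumes "sum_continuous F" and "sum_continuous G"
    and "mixed_monotone F G"
    and "\<And>(x :: 'a) (y :: 'b) (x' :: 'a) (y' :: 'b). \<exists>(z1 :: 'a) (z2 :: 'b).
           prod_comparable (z1, z2) (x, y) \<and>
           prod_comparable (z1, z2) (x', y')"
    and "k \<in> {0..<1}" "l \<in> {0..<1}" "m \<in> {0..<1}" "n \<in> {0..<1}"
    and "k + l < 1" and "m + n < 1"
    and "\<And>x u y v. x \<ge> u \<Longrightarrow> y \<le> v \<Longrightarrow>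
           dist (F (x, y)) (F (u, v)) \<le> k * dist x u + l * dist y v"
    and "\<And>x u y v. x \<le> u \<Longrightarrow> y \<ge> v \<Longrightarrow>
           dist (G (y, x)) (G (v, u)) \<le> m * dist y v + n * dist x u"
    and "x0 \<le> F (x0, y0)" and "y0 \<ge> G (y0, x0)"
  shows "\<exists>!p. FG_coupled_fixed_point F G p"
proof -
  define T where "T = coupled_map F G"
  define c where "c = max (k + l) (m + n)"
  have c: "0 \<le> c" "c < 1"
    using assms(5-10) by (auto simp: c_def)
  have mono: "prod_comparable (T p) (T q)" if "prod_comparable p q" for p q
    using that prod_le_coupled_map[OF assms(3)] unfolding prod_comparable_def T_def by blast
  have contr: "max_dist (T p) (T q) \<le> c * max_dist p q" if "prod_comparable p q" for p q
    unfolding T_def c_def using that assms(5-8)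
    by (intro max_dist_coupled_map_le assms(11,12)) auto
  \<comment> \<open>The contraction holds for comparable pairs only, so comparability of the
    iterates is carried through the induction with the bound.\<close>
  have iter: "prod_comparable ((T ^^ i) p) ((T ^^ i) q) \<and>
      max_dist ((T ^^ i) p) ((T ^^ i) q) \<le> max_dist p q * c ^ i" if "prod_comparable p q" for p q i
  proof (induction i)
    case (Suc i)
    have "max_dist ((T ^^ Suc i) p) ((T ^^ Suc i) q) \<le> c * max_dist ((T ^^ i) p) ((T ^^ i) q)"
      using contr Suc.IH by simp
    also have "\<dots> \<le> c * (max_dist p q * c ^ i)"
      using Suc.IH c by (intro mult_left_mono) auto
    finally show ?case
      using Suc.IH mono by (simp add: mult_ac)
  qed (simp add: that)

  define s where "s i = (T ^^ i) (x0, y0)" for i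
  have s_Suc: "s (Suc i) = (F (fst (s i), snd (s i)), G (snd (s i), fst (s i)))" for i
    by (simp add: s_def T_def coupled_map_def)
  \<comment> \<open>The assumptions on \<open>x0\<close> and \<open>y0\<close> say that the starting
    point lies below its image. Iterating this pair yields consecutive orbit points, since
    \<open>T ^^ i\<close> commutes with \<open>T\<close>.\<close>
  have "prod_comparable (x0, y0) (T (x0, y0))"
    using assms(13,14) by (simp add: prod_comparable_def prod_le_def T_def coupled_map_def)
  from iter[OF this]
  have step: "max_dist (s i) (s (Suc i)) \<le> max_dist (x0, y0) (T (x0, y0)) * c ^ i" for i
    by (simp add: s_def funpow_swap1)
  have "convergent (\<lambda>i. fst (s i))" "convergent (\<lambda>i. snd (s i))"
    by (rule convergent_if_dist_Suc_le_geometric[OF c order_trans[OF dist_fst_le_max_dist step]],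
        rule convergent_if_dist_Suc_le_geometric[OF c order_trans[OF dist_snd_le_max_dist step]])
  then obtain x y where x: "(\<lambda>i. fst (s i)) \<longlonglongrightarrow> x" and y: "(\<lambda>i. snd (s i)) \<longlonglongrightarrow> y"
    by (auto simp: convergent_def)
  \<comment> \<open>The shifted orbit is the image of the orbit, so by continuity it tends to the
    image of \<open>(x, y)\<close>; it also tends to \<open>(x, y)\<close> itself.\<close>
  have "(\<lambda>i. fst (s (Suc i))) \<longlonglongrightarrow> F (x, y)" "(\<lambda>i. snd (s (Suc i))) \<longlonglongrightarrow> G (y, x)"
    unfolding s_Suc fst_conv snd_conv
    by (rule tendsto_sum_continuous[OF assms(1) x y], rule tendsto_sum_continuous[OF assms(2) y x])
  then have "F (x, y) = x" "G (y, x) = y"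
    using LIMSEQ_Suc[OF x] LIMSEQ_Suc[OF y] by (auto intro: LIMSEQ_unique)
  then have "FG_coupled_fixed_point F G (x, y)"
    by (simp add: FG_coupled_fixed_point_def)
  moreover have "p = q"
    if "FG_coupled_fixed_point F G p" "FG_coupled_fixed_point F G q" for p q
  proof -
    obtain z where z: "prod_comparable z p" "prod_comparable z q"
      using assms(4)[of "fst p" "snd p" "fst q" "snd q"] by auto
    \<comment> \<open>The orbit of a fixed point \<open>r\<close> is constant, so
      \<open>iter\<close> bounds the distance from the orbit of \<open>z\<close> to \<open>r\<close>
      by a null sequence. Taking \<open>r\<close> to be \<open>p\<close> and then \<open>q\<close>,
      uniqueness of limits gives \<open>p = q\<close>.\<close>
    have "(\<lambda>i. fst ((T ^^ i) z)) \<longlonglongrightarrow> fst r \<and> (\<lambda>i. snd ((T ^^ i) z)) \<longlonglongrightarrow> snd r"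
      if r: "FG_coupled_fixed_point F G r" "prod_comparable z r" for r
    proof -
      have fixed: "(T ^^ i) r = r" for i
        using r(1) by (induction i) (simp_all add: FG_coupled_fixed_point_iff T_def)
      have bound: "max_dist ((T ^^ i) z) r \<le> max_dist z r * c ^ i" for i
        using iter[OF r(2), of i] by (simp add: fixed)
      have "(\<lambda>i. max_dist z r * c ^ i) \<longlonglongrightarrow> max_dist z r * 0"
        using c by (intro tendsto_mult tendsto_const LIMSEQ_power_zero) auto
      then have lim: "(\<lambda>i. max_dist z r * c ^ i) \<longlonglongrightarrow> 0"
        by simp
      show ?thesis
        unfolding tendsto_dist_iff[of _ "fst r"] tendsto_dist_iff[of _ "snd r"]
        by (intro conjI tendsto_sandwich[OF _ _ tendsto_const lim] always_eventually allI
            zero_le_dist order_trans[OF dist_fst_le_max_dist bound]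
            order_trans[OF dist_snd_le_max_dist bound])
    qed
    from this[OF that(1) z(1)] this[OF that(2) z(2)] show ?thesis
      by (auto simp: prod_eq_iff intro: LIMSEQ_unique)
  qed
  ultimately show ?thesis
    by blast
qed

end
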